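(* Let $2\le p\le\infty$, let $\Omega\subset\mathbb{R}^n$, $n\ge2$, be a bounded domain, let $\Omega_\infty=\Omega\times(0,\infty)$ and let $P_\infty=(\overline{\Omega}\times\{0\})\cup(\partial\Omega\times(0,\infty))$ be its parabolic boundary. Let $h\in C(P_\infty)$ be given by $h(x,0)=f(x)$ for $x\in\overline{\Omega}$ and $h(x,t)=g(x,t)$ for $(x,t)\in\partial\Omega\times[0,\infty)$. Assume that $0<\inf_\Omega f\le1\le\sup_\Omega f<\infty$ and $g(x,t)=1$ for all $(x,t)\in\partial\Omega\times[0,\infty)$. If $u\in C(\Omega_\infty\cup P_\infty)$, $u>0$, is a viscosity solution of $$\Gamma_p u=0\ \text{ in }\Omega_\infty,\qquad u(x,0)=f(x)\ \ \forall x\in\overline{\Omega},\qquad u(x,t)=1\ \ \forall (x,t)\in\partial\Omega\times[0,\infty),$$ then for every $x\in\Omega$, $\lim_{t\to\infty}u(x,t)=1$.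
   Context: Here $p=\infty$ is a label. For $2\le p<\infty$, $\Delta_p w=\mathrm{div}(|Dw|^{p-2}Dw)$ and $\Gamma_p u=\Delta_p u-(p-1)u^{p-2}u_t$; for $p=\infty$, $\Delta_\infty w=\sum_{i,j=1}^n D_iw\,D_jw\,D_{ij}w$ and $\Gamma_\infty u=\Delta_\infty u-3u^2u_t$ (spatial derivatives in $x$ only). For a $C^2$ function $\psi$ of $x$ and $p<\infty$, $\Delta_p\psi=|D\psi|^{p-2}\Delta\psi+(p-2)|D\psi|^{p-4}\Delta_\infty\psi$ where $D\psi\ne0$; for $p>2$ it is $0$ where $D\psi=0$; for $p=2$ it is $\Delta\psi$. That $h\in C(P_\infty)$ means $f\in C(\overline{\Omega})$, $g\in C(\partial\Omega\times[0,\infty))$ and $\lim_{y\to x}f(y)=g(x,0)$ for each $x\in\partial\Omega$. Viscosity solutions: a positive upper semi-continuous $u$ satisfies $\Gamma_p u\ge0$ in $\Omega_\infty$ if for every $\psi(x,t)$, $C^2$ in $x$ and $C^1$ in $t$, such that $u-\psi$ has a local maximum at $(y,s)\in\Omega_\infty$, one has $\Delta_p\psi(y,s)-(p-1)u(y,s)^{p-2}\psi_t(y,s)\ge0$ when $p<\infty$, respectively $\Delta_\infty\psi(y,s)-3u(y,s)^2\psi_t(y,s)\ge0$ when $p=\infty$. A positive lower semi-continuous $u$ satisfies $\Gamma_pu\le0$ if the reversed inequalities hold whenever $u-\psi$ has a local minimum at $(y,s)$. A continuous $u>0$ satisfies $\Gamma_pu=0$ if both hold. *)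

theory Defs
  imports "HOL-Analysis.Analysis"
begin

definition grad :: "(real^'n \<Rightarrow> real) \<Rightarrow> real^'n \<Rightarrow> real^'n" where
  "grad w x = (\<chi> i. frechet_derivative w (at x) (axis i 1))"

definition hessian :: "(real^'n \<Rightarrow> real) \<Rightarrow> real^'n \<Rightarrow> real^'n^'n" where
  "hessian w x = jacobian (grad w) (at x)"

definition laplacian :: "(real^'n \<Rightarrow> real) \<Rightarrow> real^'n \<Rightarrow> real" where
  "laplacian w x = (\<Sum>i\<in>UNIV. hessian w x $ i $ i)"

definition inf_laplacian :: "(real^'n \<Rightarrow> real) \<Rightarrow> real^'n \<Rightarrow> real" where
  "inf_laplacian w x =
     (\<Sum>i\<in>UNIV. \<Sum>j\<in>UNIV. grad w x $ i * grad w x $ j * hessian w x $ i $ j)"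

text \<open>
  For finite \<open>p\<close> this is the pointwise expansion of \<open>div (|Dw|^(p-2) Dw)\<close> for a \<open>C^2\<close>
  function \<open>w\<close>, with value \<open>0\<close> at critical points when \<open>p > 2\<close>. The case \<open>p = 2\<close> is separate
  because \<open>0 powr 0 = 0\<close>. The value \<open>p = \<infinity>\<close> is a label for the infinity-Laplacian.
\<close>

definition p_laplacian :: "ereal \<Rightarrow> (real^'n \<Rightarrow> real) \<Rightarrow> real^'n \<Rightarrow> real" where
  "p_laplacian p w x =
     (if p = \<infinity> then inf_laplacian w x
      else if p = 2 then laplacian w x
      else if grad w x = 0 then 0
      else norm (grad w x) powr (real_of_ereal p - 2) * laplacian w x
           + (real_of_ereal p - 2) * norm (grad w x) powr (real_of_ereal p - 4)
             * inf_laplacian w x)"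

text \<open>
  The expression tested in the definition of viscosity solutions: the spatial operator and the
  time derivative act on the test function \<open>\<psi>\<close>, while the zeroth-order factor is taken at the
  value of \<open>u\<close>.
\<close>

definition Gamma_test ::
    "ereal \<Rightarrow> ((real^'n) \<times> real \<Rightarrow> real) \<Rightarrow> ((real^'n) \<times> real \<Rightarrow> real) \<Rightarrow> real^'n \<Rightarrow> real \<Rightarrow> real" where
  "Gamma_test p u \<psi> y s =
     p_laplacian p (\<lambda>x. \<psi> (x, s)) y
     - (if p = \<infinity> then 3 * (u (y, s))\<^sup>2
        else (real_of_ereal p - 1) * u (y, s) powr (real_of_ereal p - 2))
       * deriv (\<lambda>t. \<psi> (y, t)) s"

definition cylinder :: "(real^'n) set \<Rightarrow> ((real^'n) \<times> real) set" where
  "cylinder \<Omega> = \<Omega> \<times> {0<..}"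

definition parabolic_boundary :: "(real^'n) set \<Rightarrow> ((real^'n) \<times> real) set" where
  "parabolic_boundary \<Omega> = closure \<Omega> \<times> {0} \<union> frontier \<Omega> \<times> {0<..}"

text \<open>
  \<open>C^2\<close> in \<open>x\<close> and \<open>C^1\<close> in \<open>t\<close>: the derivatives exist and are jointly continuous in
  \<open>(x, t)\<close>.
\<close>

definition C21_on :: "(real^'n) set \<Rightarrow> ((real^'n) \<times> real \<Rightarrow> real) \<Rightarrow> bool" where
  "C21_on \<Omega> \<psi> \<longleftrightarrow>
     (\<forall>(x, t) \<in> cylinder \<Omega>.
        (\<lambda>y. \<psi> (y, t)) differentiable (at x) \<and>
        grad (\<lambda>y. \<psi> (y, t)) differentiable (at x) \<and>
        (\<lambda>s. \<psi> (x, s)) field_differentiable (at t)) \<and>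
     continuous_on (cylinder \<Omega>) \<psi> \<and>
     continuous_on (cylinder \<Omega>) (\<lambda>(x, t). grad (\<lambda>y. \<psi> (y, t)) x) \<and>
     continuous_on (cylinder \<Omega>) (\<lambda>(x, t). hessian (\<lambda>y. \<psi> (y, t)) x) \<and>
     continuous_on (cylinder \<Omega>) (\<lambda>(x, t). deriv (\<lambda>s. \<psi> (x, s)) t)"

definition upper_semicontinuous_on :: "'a::topological_space set \<Rightarrow> ('a \<Rightarrow> real) \<Rightarrow> bool" where
  "upper_semicontinuous_on S u \<longleftrightarrow>
     (\<forall>z\<in>S. \<forall>c. u z < c \<longrightarrow> (\<forall>\<^sub>F q in at z within S. u q < c))"

definition lower_semicontinuous_on :: "'a::topological_space set \<Rightarrow> ('a \<Rightarrow> real) \<Rightarrow> bool" where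
  "lower_semicontinuous_on S u \<longleftrightarrow>
     (\<forall>z\<in>S. \<forall>c. c < u z \<longrightarrow> (\<forall>\<^sub>F q in at z within S. c < u q))"

definition local_max_at :: "('a::topological_space \<Rightarrow> real) \<Rightarrow> 'a \<Rightarrow> bool" where
  "local_max_at v z \<longleftrightarrow> (\<forall>\<^sub>F q in nhds z. v q \<le> v z)"

definition local_min_at :: "('a::topological_space \<Rightarrow> real) \<Rightarrow> 'a \<Rightarrow> bool" where
  "local_min_at v z \<longleftrightarrow> (\<forall>\<^sub>F q in nhds z. v z \<le> v q)"

definition viscosity_subsolution ::
    "ereal \<Rightarrow> (real^'n) set \<Rightarrow> ((real^'n) \<times> real \<Rightarrow> real) \<Rightarrow> bool" where
  "viscosity_subsolution p \<Omega> u \<longleftrightarrow>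
     (\<forall>z\<in>cylinder \<Omega>. 0 < u z) \<and>
     upper_semicontinuous_on (cylinder \<Omega>) u \<and>
     (\<forall>\<psi> y s. C21_on \<Omega> \<psi> \<longrightarrow> (y, s) \<in> cylinder \<Omega> \<longrightarrow>
        local_max_at (\<lambda>z. u z - \<psi> z) (y, s) \<longrightarrow> 0 \<le> Gamma_test p u \<psi> y s)"

definition viscosity_supersolution ::
    "ereal \<Rightarrow> (real^'n) set \<Rightarrow> ((real^'n) \<times> real \<Rightarrow> real) \<Rightarrow> bool" where
  "viscosity_supersolution p \<Omega> u \<longleftrightarrow>
     (\<forall>z\<in>cylinder \<Omega>. 0 < u z) \<and>
     lower_semicontinuous_on (cylinder \<Omega>) u \<and>
     (\<forall>\<psi> y s. C21_on \<Omega> \<psi> \<longrightarrow> (y, s) \<in> cylinder \<Omega> \<longrightarrow>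
        local_min_at (\<lambda>z. u z - \<psi> z) (y, s) \<longrightarrow> Gamma_test p u \<psi> y s \<le> 0)"

definition viscosity_solution ::
    "ereal \<Rightarrow> (real^'n) set \<Rightarrow> ((real^'n) \<times> real \<Rightarrow> real) \<Rightarrow> bool" where
  "viscosity_solution p \<Omega> u \<longleftrightarrow>
     continuous_on (cylinder \<Omega>) u \<and>
     viscosity_subsolution p \<Omega> u \<and> viscosity_supersolution p \<Omega> u"

text \<open>
  \<open>h \<in> C(P\<^sub>\<infinity>)\<close>, where \<open>h\<close> is given by \<open>f\<close> on the bottom and \<open>g\<close> on the lateral
  boundary of the cylinder.
\<close>

definition continuous_boundary_data ::
    "(real^'n) set \<Rightarrow> ((real^'n) \<times> real \<Rightarrow> real) \<Rightarrow> (real^'n \<Rightarrow> real) \<Rightarrow>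
     ((real^'n) \<times> real \<Rightarrow> real) \<Rightarrow> bool" where
  "continuous_boundary_data \<Omega> h f g \<longleftrightarrow>
     (\<forall>x\<in>closure \<Omega>. h (x, 0) = f x) \<and>
     (\<forall>x\<in>frontier \<Omega>. \<forall>t\<ge>0. h (x, t) = g (x, t)) \<and>
     continuous_on (closure \<Omega>) f \<and>
     continuous_on (frontier \<Omega> \<times> {0..}) g \<and>
     (\<forall>x\<in>frontier \<Omega>. (f \<longlongrightarrow> g (x, 0)) (at x within closure \<Omega>))"

end

theory Submission
  imports Defs
begin

text \<open>
  The proof traps \<open>u\<close> between two explicit smooth barriers that squeeze to nearly \<open>1\<close>. After a
  translation, \<open>\<Omega>\<close> lies in a slab where \<open>s = x\<^sub>k + c \<ge> 1\<close>, and \<open>w(x) = A - s\<^sup>2\<close> takes values in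
  \<open>[1, A]\<close> there. Since \<open>w\<close> depends on one coordinate only, is strictly concave in it and has no critical
  point in the slab, \<open>\<Delta>\<^sub>p w\<close> is an explicit negative quantity for every label \<open>p\<close>. The barriers are
  \<open>1 + \<sigma> \<theta>(t) w(x)\<close> with \<open>\<sigma> = 1\<close> (above) and \<open>\<sigma> = -1\<close> (below), where
  \<open>\<theta>(t) = \<epsilon> + K exp(-\<delta> t)\<close>. The constant \<open>K\<close> takes care of the initial data, and \<open>\<epsilon>\<close> keeps the
  spatial term \<open>\<Delta>\<^sub>p\<close> bounded away from zero for all times. The time term has the wrong sign
  because \<open>\<theta>\<close> decreases, but it is of size \<open>\<delta>\<close> times the coefficient \<open>(p - 1) u\<^sup>p\<^sup>-\<^sup>2\<close>
  (or \<open>3 u\<^sup>2\<close>), so it is dominated once \<open>u\<close> is bounded above and \<open>\<delta>\<close> is small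
  (\<open>strict_barrier\<close>). If \<open>u\<close> crossed a barrier, then the barrier, shifted by a small penalty in
  time, would touch \<open>u\<close>. As the barriers are smooth, it would be a test function there and violate the
  viscosity inequality (\<open>barrier_bound\<close>).

  The comparison is used twice. With \<open>\<delta> = 0\<close> the time term vanishes whatever the size of \<open>u\<close>,
  and the upper barrier yields \<open>u \<le> M\<close>. With this \<open>M\<close>, a small \<open>\<epsilon>\<close> and then a small \<open>\<delta>\<close> give
  \<open>\<bar>u - 1\<bar> \<le> (\<epsilon> + K exp(-\<delta> t)) A\<close>, whose right-hand side tends to \<open>\<epsilon> A\<close>.
\<close>

section \<open>The coefficient of the time derivative\<close>

definition time_coeff :: "ereal \<Rightarrow> real \<Rightarrow> real" where
  "time_coeff p v = (if p = \<infinity> then 3 * v\<^sup>2 else (real_of_ereal p - 1) * v powr (real_of_ereal p - 2))"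

lemma time_coeff_mono:
  assumes "2 \<le> p" "0 \<le> v" "v \<le> w"
  shows "time_coeff p v \<le> time_coeff p w"
  using assms
  by (cases p) (auto simp: time_coeff_def intro!: mult_left_mono powr_mono2 power_mono)

lemma time_coeff_pos:
  assumes "2 \<le> p" "0 < v"
  shows "0 < time_coeff p v"
  using assms by (cases p) (auto simp: time_coeff_def)

section \<open>Test functions quadratic in one coordinate\<close>

lemma has_derivative_ridge:
  fixes x :: "real^'n"
  shows "((\<lambda>x. a + b * (x $ k + c)\<^sup>2) has_derivative (\<lambda>h. 2 * b * (x $ k + c) * h $ k)) (at x)"
  by (auto intro!: derivative_eq_intros bounded_linear.has_derivative[OF bounded_linear_vec_nth]
      simp: algebra_simps)

lemma grad_ridge:
  fixes x :: "real^'n"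
  shows "grad (\<lambda>x. a + b * (x $ k + c)\<^sup>2) x = (2 * b * (x $ k + c)) *\<^sub>R axis k 1"
  unfolding grad_def frechet_derivative_at[OF has_derivative_ridge, symmetric]
  by (simp add: vec_eq_iff axis_def)

lemma has_derivative_grad_ridge:
  fixes x :: "real^'n"
  shows "(grad (\<lambda>x. a + b * (x $ k + c)\<^sup>2) has_derivative (\<lambda>h. (2 * b * h $ k) *\<^sub>R axis k 1)) (at x)"
  unfolding grad_ridge[abs_def]
  by (auto intro!: derivative_eq_intros bounded_linear.has_derivative[OF bounded_linear_vec_nth])

lemma hessian_ridge:
  fixes x :: "real^'n"
  shows "hessian (\<lambda>x. a + b * (x $ k + c)\<^sup>2) x = (\<chi> i j. if i = k \<and> j = k then 2 * b else 0)"
  unfolding hessian_def jacobian_def frechet_derivative_at[OF has_derivative_grad_ridge, symmetric]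
  by (auto simp: vec_eq_iff matrix_def axis_def)

lemma laplacian_ridge:
  fixes x :: "real^'n"
  shows "laplacian (\<lambda>x. a + b * (x $ k + c)\<^sup>2) x = 2 * b"
  by (simp add: laplacian_def hessian_ridge)

lemma inf_laplacian_ridge:
  fixes x :: "real^'n"
  shows "inf_laplacian (\<lambda>x. a + b * (x $ k + c)\<^sup>2) x = 2 * b * (2 * b * (x $ k + c))\<^sup>2"
proof -
  have "inf_laplacian (\<lambda>x. a + b * (x $ k + c)\<^sup>2) x
      = (\<Sum>i\<in>UNIV. \<Sum>j\<in>UNIV. if j = k then if i = k then 2 * b * (2 * b * (x $ k + c))\<^sup>2 else 0 else 0)"
    unfolding inf_laplacian_def hessian_ridge grad_ridge
    by (intro sum.cong) (auto simp: axis_def power2_eq_square)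
  then show ?thesis by simp
qed

text \<open>
  For a function of one coordinate both terms of \<open>\<Delta>\<^sub>p\<close> are proportional to \<open>\<bar>\<psi>'\<bar>\<^sup>p\<^sup>-\<^sup>2 \<psi>''\<close>, and the
  factor \<open>1 + (p - 2)\<close> is the one in the coefficient of \<open>u\<^sub>t\<close>. Hence \<open>time_coeff\<close> reappears,
  now evaluated at \<open>\<bar>\<psi>'\<bar>\<close>. For \<open>p = \<infinity>\<close> its factor \<open>3\<close> is absent from \<open>\<Delta>\<^sub>\<infinity>\<close>, which the
  division compensates.
\<close>

lemma p_laplacian_ridge:
  fixes x :: "real^'n"
  assumes "2 \<le> p" "b \<noteq> 0" "x $ k + c \<noteq> 0"
  shows "p_laplacian p (\<lambda>x. a + b * (x $ k + c)\<^sup>2) x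
    = 2 * b * time_coeff p \<bar>2 * b * (x $ k + c)\<bar> / (if p = \<infinity> then 3 else 1)"
proof -
  define m where "m = \<bar>2 * b * (x $ k + c)\<bar>"
  have m: "m > 0" using assms by (simp add: m_def)
  have nm: "norm (grad (\<lambda>x. a + b * (x $ k + c)\<^sup>2) x) = m"
    unfolding grad_ridge m_def by simp
  have sq: "(2 * b * (x $ k + c))\<^sup>2 = m\<^sup>2" unfolding m_def by simp
  have nz: "grad (\<lambda>x. a + b * (x $ k + c)\<^sup>2) x \<noteq> 0" using nm m by auto
  show ?thesis
  proof (cases p)
    case (real r)
    have "m powr (r - 2) = m powr (r - 4) * m powr 2"
      by (simp flip: powr_add)
    then have split: "m powr (r - 2) = m powr (r - 4) * m\<^sup>2"
      using m by simp
    have "(r - 2) * m powr (r - 4) * (2 * b * m\<^sup>2) = (r - 2) * (2 * b) * m powr (r - 2)"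
      unfolding split by (simp only: mult_ac)
    then show ?thesis
      using real m nz
      unfolding p_laplacian_def laplacian_ridge inf_laplacian_ridge nm sq time_coeff_def m_def[symmetric]
      by (auto simp: algebra_simps)
  next
    case PInf
    then show ?thesis
      unfolding p_laplacian_def inf_laplacian_ridge sq time_coeff_def m_def[symmetric] by simp
  next
    case MInf
    then show ?thesis using assms by simp
  qed
qed

lemma C21_on_ridge:
  fixes \<Omega> :: "(real^'n) set"
  assumes \<alpha>: "\<And>t. (\<alpha> has_real_derivative \<alpha>' t) (at t)" "continuous_on UNIV \<alpha>'"
    and \<beta>: "\<And>t. (\<beta> has_real_derivative \<beta>' t) (at t)" "continuous_on UNIV \<beta>'"
  shows "C21_on \<Omega> (\<lambda>(x, t). \<alpha> t + \<beta> t * (x $ k + c)\<^sup>2)"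
proof -
  have deriv: "((\<lambda>t. \<alpha> t + \<beta> t * d) has_real_derivative \<alpha>' t + \<beta>' t * d) (at t)" for d t
    by (auto intro!: derivative_eq_intros \<alpha>(1) \<beta>(1))
  have cont: "continuous_on UNIV \<alpha>" "continuous_on UNIV \<beta>"
    using \<alpha>(1) \<beta>(1) by (meson DERIV_isCont continuous_at_imp_continuous_on)+
  have snd: "continuous_on (cylinder \<Omega>) (\<lambda>z. \<gamma> (snd z))" if "continuous_on UNIV \<gamma>" for \<gamma> :: "real \<Rightarrow> real"
    by (rule continuous_on_compose2[OF that]) (auto intro!: continuous_intros)
  have "continuous_on (cylinder \<Omega>) (\<lambda>z. \<chi> i j. if i = k \<and> j = k then 2 * \<beta> (snd z) else 0)"
  proof (intro continuous_on_vec_lambda)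
    fix i j
    show "continuous_on (cylinder \<Omega>) (\<lambda>z. if i = k \<and> j = k then 2 * \<beta> (snd z) else 0)"
      by (cases "i = k \<and> j = k") (auto intro!: snd[OF cont(2)] continuous_intros)
  qed
  then show ?thesis
    unfolding C21_on_def split_def
    by (auto intro!: continuous_intros snd cont \<alpha>(2) \<beta>(2) differentiableI
        has_derivative_ridge has_derivative_grad_ridge
        simp: grad_ridge hessian_ridge DERIV_imp_deriv[OF deriv] field_differentiable_def
        intro: deriv)
qed

section \<open>Comparison with the barriers\<close>

text \<open>
  The sign \<open>\<sigma>\<close> turns the inequalities for sub- and supersolutions into one, so that upper and
  lower barriers can be treated together.
\<close>

lemma viscosity_solution_signed_test:
  assumes "viscosity_solution p \<Omega> u" "\<sigma> = 1 \<or> \<sigma> = - 1" "C21_on \<Omega> \<psi>" "(y, s) \<in> cylinder \<Omega>"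
    and "local_max_at (\<lambda>z. \<sigma> * (u z - \<psi> z)) (y, s)"
  shows "0 \<le> \<sigma> * Gamma_test p u \<psi> y s"
  using assms(2)
proof
  assume "\<sigma> = 1"
  then show ?thesis
    using assms unfolding viscosity_solution_def viscosity_subsolution_def by simp
next
  assume "\<sigma> = - 1"
  moreover from this have "local_min_at (\<lambda>z. u z - \<psi> z) (y, s)"
    using assms(5) unfolding local_max_at_def local_min_at_def by (auto elim: eventually_mono)
  ultimately show ?thesis
    using assms unfolding viscosity_solution_def viscosity_supersolution_def by simp
qed

lemma Gamma_test_ridge:
  fixes y :: "real^'n"
  assumes "(\<alpha> has_real_derivative \<alpha>') (at s)" "(\<beta> has_real_derivative \<beta>') (at s)"
    and "2 \<le> p" "\<beta> s \<noteq> 0" "y $ k + c \<noteq> 0"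
  shows "Gamma_test p u (\<lambda>(x, t). \<alpha> t + \<beta> t * (x $ k + c)\<^sup>2) y s
    = 2 * \<beta> s * time_coeff p \<bar>2 * \<beta> s * (y $ k + c)\<bar> / (if p = \<infinity> then 3 else 1)
      - time_coeff p (u (y, s)) * (\<alpha>' + \<beta>' * (y $ k + c)\<^sup>2)"
proof -
  have "((\<lambda>t. \<alpha> t + \<beta> t * (y $ k + c)\<^sup>2) has_real_derivative \<alpha>' + \<beta>' * (y $ k + c)\<^sup>2) (at s)"
    by (auto intro!: derivative_eq_intros assms)
  from DERIV_imp_deriv[OF this] show ?thesis
    using p_laplacian_ridge[OF assms(3-5), of "\<alpha> s"]
    by (simp add: Gamma_test_def time_coeff_def)
qed

text \<open>
  The test function is the barrier \<open>1 + \<sigma> \<theta>(t) (A - (x\<^sub>k + c)\<^sup>2)\<close> plus a penalty \<open>\<sigma> \<eta> exp(N (t - t0))\<close>.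
  The penalty increases with time, so it only helps. In the slab the slope of the barrier is at
  least \<open>2 \<epsilon>\<close> in absolute value, whence the lower bound \<open>2/3 \<epsilon> time_coeff p \<epsilon>\<close> for the
  spatial term; the factor \<open>1/3\<close> is only lost when \<open>p = \<infinity>\<close>.
\<close>

lemma strict_barrier:
  fixes y :: "real^'n"
  assumes p: "2 \<le> p" and \<sigma>: "\<sigma> = 1 \<or> \<sigma> = - 1" and \<epsilon>: "0 < \<epsilon>" and K: "0 \<le> K" and \<delta>: "0 \<le> \<delta>"
    and slab: "1 \<le> y $ k + c" "(y $ k + c)\<^sup>2 \<le> A"
    and \<eta>: "0 \<le> \<eta>" "0 \<le> N" and s: "0 \<le> s" and u: "0 < u (y, s)"
    and slow: "time_coeff p (u (y, s)) * (\<delta> * K * A) < 2 / 3 * \<epsilon> * time_coeff p \<epsilon>"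
  shows "\<sigma> * Gamma_test p u (\<lambda>(x, t). (1 + \<sigma> * ((\<epsilon> + K * exp (- \<delta> * t)) * A + \<eta> * exp (N * (t - t0))))
     + - \<sigma> * (\<epsilon> + K * exp (- \<delta> * t)) * (x $ k + c)\<^sup>2) y s < 0"
proof -
  define \<theta> where "\<theta> = \<epsilon> + K * exp (- \<delta> * s)"
  define d where "d = y $ k + c"
  define C where "C = time_coeff p (u (y, s))"
  define L where "L = time_coeff p \<bar>2 * (- \<sigma> * \<theta>) * d\<bar>"
  have \<theta>: "\<epsilon> \<le> \<theta>" unfolding \<theta>_def using K by simp
  have C: "0 \<le> C" unfolding C_def using time_coeff_pos[OF p u] by simp
  have "\<epsilon> * 1 \<le> (2 * \<theta>) * d"
    using \<theta> \<epsilon> slab unfolding d_def by (intro mult_mono) auto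
  also have "\<dots> = \<bar>2 * (- \<sigma> * \<theta>) * d\<bar>"
    using \<sigma> \<theta> \<epsilon> slab unfolding d_def by (auto simp: abs_mult)
  finally have L: "time_coeff p \<epsilon> \<le> L"
    unfolding L_def using \<epsilon> by (intro time_coeff_mono[OF p]) auto
  have L0: "0 < L" using L time_coeff_pos[OF p \<epsilon>] by simp
  have deriv:
    "((\<lambda>t. 1 + \<sigma> * ((\<epsilon> + K * exp (- \<delta> * t)) * A + \<eta> * exp (N * (t - t0)))) has_real_derivative
       \<sigma> * (- \<delta> * K * exp (- \<delta> * s) * A + \<eta> * N * exp (N * (s - t0)))) (at s)"
    "((\<lambda>t. - \<sigma> * (\<epsilon> + K * exp (- \<delta> * t))) has_real_derivative
       \<sigma> * \<delta> * K * exp (- \<delta> * s)) (at s)"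
    by (auto intro!: derivative_eq_intros)
  have nz: "- \<sigma> * \<theta> \<noteq> 0" "y $ k + c \<noteq> 0"
    using \<sigma> \<theta> \<epsilon> slab by auto
  have "\<sigma> * Gamma_test p u (\<lambda>(x, t). (1 + \<sigma> * ((\<epsilon> + K * exp (- \<delta> * t)) * A + \<eta> * exp (N * (t - t0))))
     + - \<sigma> * (\<epsilon> + K * exp (- \<delta> * t)) * (x $ k + c)\<^sup>2) y s
     = \<sigma> * (2 * (- \<sigma> * \<theta>) * L / (if p = \<infinity> then 3 else 1)
       - C * (\<sigma> * (- \<delta> * K * exp (- \<delta> * s) * A + \<eta> * N * exp (N * (s - t0)))
           + \<sigma> * \<delta> * K * exp (- \<delta> * s) * d\<^sup>2))"
    unfolding \<theta>_def d_def C_def L_def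
    by (subst Gamma_test_ridge[OF deriv p]) (use nz in \<open>simp_all add: \<theta>_def\<close>)
  also have "\<dots> = - (2 * \<theta> * L / (if p = \<infinity> then 3 else 1))
      + C * (\<delta> * K * exp (- \<delta> * s) * (A - d\<^sup>2)) - C * (\<eta> * N * exp (N * (s - t0)))"
    using \<sigma> by (auto simp: algebra_simps)
  also have "\<dots> < 0"
  proof -
    have "2 / 3 * \<epsilon> * time_coeff p \<epsilon> \<le> 2 / 3 * \<theta> * L"
      using \<theta> \<epsilon> L time_coeff_pos[OF p \<epsilon>] by (intro mult_mono) auto
    also have "\<dots> \<le> 2 * \<theta> * L / (if p = \<infinity> then 3 else 1)"
      using \<theta> \<epsilon> L0 by auto
    finally have 1: "2 / 3 * \<epsilon> * time_coeff p \<epsilon> \<le> 2 * \<theta> * L / (if p = \<infinity> then 3 else 1)" .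
    have "\<delta> * K * exp (- \<delta> * s) * (A - d\<^sup>2) \<le> \<delta> * K * 1 * A"
      using \<delta> K s slab unfolding d_def by (intro mult_mono) auto
    then have 2: "C * (\<delta> * K * exp (- \<delta> * s) * (A - d\<^sup>2)) \<le> C * (\<delta> * K * A)"
      using C by (intro mult_left_mono) auto
    have 3: "0 \<le> C * (\<eta> * N * exp (N * (s - t0)))"
      using C \<eta> by simp
    show ?thesis using 1 2 3 slow unfolding C_def by linarith
  qed
  finally show ?thesis .
qed

text \<open>
  If \<open>\<sigma> (u - 1)\<close> exceeded the barrier \<open>\<theta> w\<close> at \<open>(x0, t0)\<close>, then the excess minus the penalty would have
  a positive maximum over \<open>closure \<Omega> \<times> {0..T}\<close> with \<open>T > t0\<close>. The data exclude the bottom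
  and the lateral boundary as its location, the penalty excludes the final time \<open>T\<close>, and at an interior
  point \<open>strict_barrier\<close> contradicts the viscosity inequality. The final time must be excluded because
  test functions touch \<open>u\<close> in a full neighbourhood, including later times.
\<close>

lemma barrier_bound:
  fixes \<Omega> :: "(real^'n) set"
  assumes p: "2 \<le> p" and \<Omega>: "open \<Omega>" "bounded \<Omega>"
    and cont: "continuous_on (cylinder \<Omega> \<union> parabolic_boundary \<Omega>) u"
    and visc: "viscosity_solution p \<Omega> u"
    and lateral: "\<And>x t. x \<in> frontier \<Omega> \<Longrightarrow> 0 \<le> t \<Longrightarrow> u (x, t) = 1"
    and \<sigma>: "\<sigma> = 1 \<or> \<sigma> = - 1"
    and slab: "\<And>x. x \<in> closure \<Omega> \<Longrightarrow> 1 \<le> x $ k + c \<and> (x $ k + c)\<^sup>2 + 1 \<le> A"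
    and \<epsilon>: "0 < \<epsilon>" and K: "0 \<le> K" and \<delta>: "0 \<le> \<delta>"
    and initial: "\<And>x. x \<in> closure \<Omega> \<Longrightarrow> \<sigma> * (u (x, 0) - 1) \<le> K"
    and slow: "\<And>z. z \<in> cylinder \<Omega> \<Longrightarrow>
      time_coeff p (u z) * (\<delta> * K * A) < 2 / 3 * \<epsilon> * time_coeff p \<epsilon>"
    and x0: "x0 \<in> \<Omega>" and t0: "0 < t0"
  shows "\<sigma> * (u (x0, t0) - 1) \<le> (\<epsilon> + K * exp (- \<delta> * t0)) * A"
proof -
  define \<theta> where "\<theta> = (\<lambda>t. \<epsilon> + K * exp (- \<delta> * t))"
  define w where "w = (\<lambda>x::real^'n. A - (x $ k + c)\<^sup>2)"
  define v where "v = (\<lambda>z. \<sigma> * (u z - 1) - \<theta> (snd z) * w (fst z))"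
  have \<theta>0: "0 < \<theta> t" for t unfolding \<theta>_def using \<epsilon> K by (intro add_pos_nonneg) auto
  have w1: "1 \<le> w x" if "x \<in> closure \<Omega>" for x using slab[OF that] by (simp add: w_def)
  have "v (x0, t0) \<le> 0"
  proof (rule ccontr)
    assume "\<not> v (x0, t0) \<le> 0"
    define \<eta> where "\<eta> = v (x0, t0) / 2"
    define T where "T = t0 + 1"
    define Q where "Q = closure \<Omega> \<times> {0..T}"
    have \<eta>: "0 < \<eta>" using \<open>\<not> v (x0, t0) \<le> 0\<close> by (simp add: \<eta>_def)
    have Q: "compact Q"
      unfolding Q_def using \<Omega> by (intro compact_Times) auto
    have Qsub: "Q \<subseteq> cylinder \<Omega> \<union> parabolic_boundary \<Omega>"
      using \<Omega> by (auto simp: Q_def cylinder_def parabolic_boundary_def frontier_def interior_open)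
    have contv: "continuous_on Q v"
      unfolding v_def \<theta>_def w_def
      by (intro continuous_intros continuous_on_subset[OF cont Qsub])
    obtain B where B: "\<And>z. z \<in> Q \<Longrightarrow> v z \<le> B"
      using compact_imp_bounded[OF compact_continuous_image[OF contv Q]]
      unfolding bounded_iff by (metis abs_le_D1 imageI real_norm_def)
    \<comment> \<open>The penalty is half the excess at time \<open>t0\<close>, and \<open>N\<close> makes it larger than \<open>B\<close> at time \<open>T = t0 + 1\<close>.\<close>
    define N where "N = \<bar>B\<bar> / \<eta>"
    define P where "P = (\<lambda>t. \<eta> * exp (N * (t - t0)))"
    have N: "0 \<le> N" using \<eta> by (simp add: N_def)
    have P0: "0 < P t" for t using \<eta> by (simp add: P_def)
    have "B \<le> \<eta> * N" using \<eta> by (simp add: N_def)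
    also have "\<dots> < \<eta> * exp N" 
      using \<eta> exp_ge_add_one_self[of N] by (intro mult_strict_left_mono) linarith+
    finally have PT: "B < P T" by (simp add: P_def T_def)
    have "continuous_on Q (\<lambda>z. v z - P (snd z))"
      unfolding P_def by (intro continuous_intros contv)
    moreover have in0: "(x0, t0) \<in> Q"
      using x0 t0 closure_subset by (auto simp: Q_def T_def)
    ultimately obtain z where z: "z \<in> Q" and zmax: "\<And>z'. z' \<in> Q \<Longrightarrow> v z' - P (snd z') \<le> v z - P (snd z)"
      using continuous_attains_sup[OF Q, of "\<lambda>z. v z - P (snd z)"] by blast
    obtain y s where ys: "z = (y, s)" by (cases z)
    have pos: "0 < v (y, s) - P s"
      using zmax[OF in0] \<eta> by (simp add: ys P_def \<eta>_def)
    have y: "y \<in> closure \<Omega>" and s: "0 \<le> s" "s \<le> T" using z by (auto simp: ys Q_def)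
    have "s \<noteq> 0"
    proof
      assume "s = 0"
      have "K * 1 \<le> \<theta> 0 * w y"
        using \<epsilon> K w1[OF y] by (intro mult_mono) (auto simp: \<theta>_def)
      then have "v (y, 0) \<le> 0"
        using initial[OF y] by (simp add: v_def)
      then show False using pos P0[of s] \<open>s = 0\<close> by simp
    qed
    moreover have "s \<noteq> T" using pos PT B[OF z] ys by auto
    ultimately have s': "0 < s" "s < T" using s by auto
    have "y \<notin> frontier \<Omega>"
    proof
      assume "y \<in> frontier \<Omega>"
      then have "v (y, s) \<le> 0"
        using lateral s \<theta>0[of s] w1[OF y] by (simp add: v_def)
      then show False using pos P0[of s] by simp
    qed
    then have y': "y \<in> \<Omega>" using y \<Omega> by (auto simp: frontier_def interior_open)
    have cyl: "(y, s) \<in> cylinder \<Omega>" using y' s' by (simp add: cylinder_def)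
    define \<psi> where "\<psi> = (\<lambda>(x::real^'n, t). (1 + \<sigma> * ((\<epsilon> + K * exp (- \<delta> * t)) * A + \<eta> * exp (N * (t - t0))))
     + - \<sigma> * (\<epsilon> + K * exp (- \<delta> * t)) * (x $ k + c)\<^sup>2)"
    have \<psi>: "\<sigma> * (u z - \<psi> z) = v z - P (snd z)" for z
      using \<sigma> by (cases z) (auto simp: \<psi>_def v_def P_def \<theta>_def w_def algebra_simps)
    have "C21_on \<Omega> \<psi>"
      unfolding \<psi>_def
      by (rule C21_on_ridge[where \<alpha>' = "\<lambda>t. \<sigma> * (- \<delta> * K * exp (- \<delta> * t) * A + \<eta> * N * exp (N * (t - t0)))"
          and \<beta>' = "\<lambda>t. \<sigma> * \<delta> * K * exp (- \<delta> * t)"])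
        (auto intro!: derivative_eq_intros continuous_intros)
    moreover have "local_max_at (\<lambda>z. \<sigma> * (u z - \<psi> z)) (y, s)"
      unfolding local_max_at_def
    proof (rule eventually_nhds[THEN iffD2])
      have "open (\<Omega> \<times> {0<..<T})" "(y, s) \<in> \<Omega> \<times> {0<..<T}" "\<Omega> \<times> {0<..<T} \<subseteq> Q"
        using \<Omega> y' s' closure_subset by (auto simp: Q_def intro!: open_Times)
      then show "\<exists>S. open S \<and> (y, s) \<in> S \<and> (\<forall>q\<in>S. \<sigma> * (u q - \<psi> q) \<le> \<sigma> * (u (y, s) - \<psi> (y, s)))"
        using zmax unfolding \<psi> ys by blast
    qed
    ultimately have "0 \<le> \<sigma> * Gamma_test p u \<psi> y s"
      using viscosity_solution_signed_test[OF visc \<sigma>] cyl by blast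
    moreover have "\<sigma> * Gamma_test p u \<psi> y s < 0"
      unfolding \<psi>_def
      by (rule strict_barrier[OF p \<sigma> \<epsilon> K \<delta>])
        (use slab[OF y] \<eta> N s visc cyl slow[OF cyl] in
          \<open>auto simp: viscosity_solution_def viscosity_subsolution_def\<close>)
    ultimately show False by simp
  qed
  then have "\<sigma> * (u (x0, t0) - 1) \<le> \<theta> t0 * w x0" by (simp add: v_def)
  also have "\<dots> \<le> \<theta> t0 * A" using \<theta>0[of t0] by (simp add: w_def)
  finally show ?thesis by (simp add: \<theta>_def)
qed

theorem theorem1p2:
  fixes p :: ereal
    and \<Omega> :: "(real^'n) set"
    and f :: "real^'n \<Rightarrow> real"
    and g h u :: "(real^'n) \<times> real \<Rightarrow> real"
  assumes "2 \<le> p"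
    and "2 \<le> CARD('n)"
    and "open \<Omega>" and "connected \<Omega>" and "\<Omega> \<noteq> {}" and "bounded \<Omega>"
    and "continuous_boundary_data \<Omega> h f g"
    and "0 < (INF x\<in>\<Omega>. ereal (f x))" and "(INF x\<in>\<Omega>. ereal (f x)) \<le> 1"
    and "1 \<le> (SUP x\<in>\<Omega>. ereal (f x))" and "(SUP x\<in>\<Omega>. ereal (f x)) < \<infinity>"
    and "\<forall>x\<in>frontier \<Omega>. \<forall>t\<ge>0. g (x, t) = 1"
    and "continuous_on (cylinder \<Omega> \<union> parabolic_boundary \<Omega>) u"
    and "\<forall>z\<in>cylinder \<Omega> \<union> parabolic_boundary \<Omega>. 0 < u z"
    and "viscosity_solution p \<Omega> u"
    and "\<forall>x\<in>closure \<Omega>. u (x, 0) = f x"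
    and "\<forall>x\<in>frontier \<Omega>. \<forall>t\<ge>0. u (x, t) = 1"
  shows "\<forall>x\<in>\<Omega>. ((\<lambda>t. u (x, t)) \<longlongrightarrow> 1) at_top"
proof
  note p = \<open>2 \<le> p\<close> and visc = \<open>viscosity_solution p \<Omega> u\<close>
  have lateral: "\<And>x t. x \<in> frontier \<Omega> \<Longrightarrow> 0 \<le> t \<Longrightarrow> u (x, t) = 1" using assms by blast
  have compact: "compact (closure \<Omega>)" using \<open>bounded \<Omega>\<close> by simp
  have pos: "0 < u z" if "z \<in> cylinder \<Omega>" for z using assms that by blast
  have pos0: "0 < u (x, 0)" if "x \<in> closure \<Omega>" for x
    using assms(14) that unfolding parabolic_boundary_def by blast
  obtain k :: 'n where True by simp
  obtain r where r: "\<And>x. x \<in> closure \<Omega> \<Longrightarrow> norm x \<le> r"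
    using compact_imp_bounded[OF compact] by (auto simp: bounded_iff)
  define c where "c = r + 1"
  define A where "A = (2 * r + 1)\<^sup>2 + 1"
  have slab: "1 \<le> x $ k + c \<and> (x $ k + c)\<^sup>2 + 1 \<le> A" if "x \<in> closure \<Omega>" for x
  proof -
    have "\<bar>x $ k\<bar> \<le> r" using r[OF that] component_le_norm_cart[of x k] by linarith
    then show ?thesis unfolding c_def A_def by (auto intro!: power_mono)
  qed
  have A: "0 < A" unfolding A_def by (simp add: add_nonneg_pos)
  have "continuous_on (closure \<Omega>) f"
    using assms by (simp add: continuous_boundary_data_def)
  then obtain F where F: "\<And>x. x \<in> closure \<Omega> \<Longrightarrow> \<bar>f x\<bar> \<le> F"
    using compact_imp_bounded[OF compact_continuous_image[OF _ compact]]
    by (force simp: bounded_iff)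
  \<comment> \<open>\<open>F\<close> serves the upper barrier; \<open>1\<close> suffices for the lower one, as \<open>1 - u < 1\<close>.\<close>
  define K where "K = max 1 F"
  have K: "1 \<le> K" by (simp add: K_def)
  have initial: "\<sigma> * (u (x, 0) - 1) \<le> K" if "\<sigma> = 1 \<or> \<sigma> = -1" "x \<in> closure \<Omega>" for x \<sigma>
    using F[OF that(2)] pos0[OF that(2)] that assms by (auto simp: K_def)
  note barrier = barrier_bound[OF p \<open>open \<Omega>\<close> \<open>bounded \<Omega>\<close> assms(13) visc lateral _ slab]
  \<comment> \<open>The stationary upper barrier, \<open>\<delta> = 0\<close> and \<open>\<epsilon> = 1\<close>, bounds \<open>u\<close> uniformly in time.\<close>
  define M where "M = 1 + (1 + K) * A"
  have M: "u z \<le> M" if "z \<in> cylinder \<Omega>" for z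
  proof -
    have "1 * (u (fst z, snd z) - 1) \<le> (1 + K * exp (- 0 * snd z)) * A"
      by (rule barrier) (use that K initial[of 1] time_coeff_pos[OF p, of 1] in \<open>auto simp: cylinder_def\<close>)
    then show ?thesis by (simp add: M_def)
  qed
  have M0: "0 < M" unfolding M_def using A K by (simp add: add_pos_pos)
  fix x assume x: "x \<in> \<Omega>"
  show "((\<lambda>t. u (x, t)) \<longlongrightarrow> 1) at_top"
  proof (rule tendstoI)
    fix e :: real assume e: "0 < e"
    \<comment> \<open>The limit \<open>\<epsilon> A\<close> of the barrier is \<open>e / 2\<close>.\<close>
    define \<epsilon> where "\<epsilon> = e / (2 * A)"
    have \<epsilon>: "0 < \<epsilon>" using e A by (simp add: \<epsilon>_def)
    define S where "S = time_coeff p M * (K * A)"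
    have S: "0 < S" unfolding S_def using time_coeff_pos[OF p M0] K A by simp
    \<comment> \<open>\<open>\<delta>\<close> makes the time term at most \<open>1/2 \<epsilon> time_coeff p \<epsilon>\<close>, less than the required \<open>2/3\<close> of it.\<close>
    define \<delta> where "\<delta> = \<epsilon> * time_coeff p \<epsilon> / (2 * S)"
    have \<delta>: "0 < \<delta>" using \<epsilon> S time_coeff_pos[OF p \<epsilon>] by (simp add: \<delta>_def)
    have slow: "time_coeff p (u z) * (\<delta> * K * A) < 2 / 3 * \<epsilon> * time_coeff p \<epsilon>"
      if "z \<in> cylinder \<Omega>" for z
    proof -
      have "time_coeff p (u z) * (\<delta> * K * A) \<le> time_coeff p M * (\<delta> * K * A)"
        using time_coeff_mono[OF p _ M[OF that]] pos[OF that] \<delta> K A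
        by (intro mult_right_mono) auto
      also have "\<dots> = \<delta> * S" by (simp add: S_def)
      also have "\<dots> = \<epsilon> * time_coeff p \<epsilon> / 2" using S by (simp add: \<delta>_def)
      also have "\<dots> < 2 / 3 * \<epsilon> * time_coeff p \<epsilon>" 
        using mult_pos_pos[OF \<epsilon> time_coeff_pos[OF p \<epsilon>]] by simp
      finally show ?thesis .
    qed
    have bound: "\<bar>u (x, t) - 1\<bar> \<le> (\<epsilon> + K * exp (- \<delta> * t)) * A" if "0 < t" for t
    proof -
      have "\<sigma> * (u (x, t) - 1) \<le> (\<epsilon> + K * exp (- \<delta> * t)) * A" if "\<sigma> = 1 \<or> \<sigma> = - 1" for \<sigma>
        by (rule barrier) (use \<open>0 < t\<close> that x K \<epsilon> \<delta> initial slow in auto)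
      from this[of 1] this[of "- 1"] show ?thesis by auto
    qed
    have "filterlim (\<lambda>t. - \<delta> * t) at_bot at_top"
      by (rule filterlim_tendsto_neg_mult_at_bot[OF tendsto_const _ filterlim_ident]) (use \<delta> in simp)
    then have "((\<lambda>t. (\<epsilon> + K * exp (- \<delta> * t)) * A) \<longlongrightarrow> (\<epsilon> + K * 0) * A) at_top"
      by (intro tendsto_intros filterlim_compose[OF exp_at_bot])
    moreover have "(\<epsilon> + K * 0) * A < e" using e A by (simp add: \<epsilon>_def)
    ultimately have "\<forall>\<^sub>F t in at_top. (\<epsilon> + K * exp (- \<delta> * t)) * A < e"
      by (rule order_tendstoD)
    then show "\<forall>\<^sub>F t in at_top. dist (u (x, t)) 1 < e"
      using eventually_gt_at_top[of 0]
      by eventually_elim (use bound in \<open>fastforce simp: dist_real_def\<close>)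
  qed
qed

end
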